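(* Let $P$ and $Q$ be finite graded posets and let $f:P\to Q$ be a surjective rank-preserving poset map. Assume that for every $q\in Q$ the fiber $f^{-1}(\langle q\rangle)$ is strongly constructible. If $Q$ is strongly constructible, then so is $P$.
   Context: A poset is graded if all its maximal chains have the same length (its rank); ranks of elements are lengths of maximal chains below them, and a rank-preserving map preserves ranks of elements. $\langle q\rangle=\{q'\in Q: q'\le q\}$. A poset is bounded if it has a minimum and a maximum; it is (pure) shellable if its order complex (simplicial complex of chains) is pure and shellable, i.e. its facets admit an order $F_1,\dots,F_m$ such that for each $i\ge2$ the intersection of the simplex on $F_i$ with the complex generated by $F_1,\dots,F_{i-1}$ is generated by a nonempty set of maximal proper faces of $F_i$. A graded poset $P$ of rank $n$ with a minimum element is strongly constructible if either (i) $P$ is bounded and pure shellable, or (ii) $P$ is the union of two strongly constructible proper order ideals $J_1,J_2$ of rank $n$ such that $J_1\cap J_2$ is a strongly constructible poset of rank at least $n-1$. *)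

theory Defs
  imports Main
begin

text \<open>
  A poset is a subset \<open>P\<close> of a type of class \<open>order\<close>, with the induced order;
  subposets and order ideals are then subsets.  A simplicial complex is the set of its faces,
  the empty face included.
\<close>

definition poset_chains :: "'a::order set \<Rightarrow> 'a set set" where
  "poset_chains P = {C. C \<subseteq> P \<and> Complete_Partial_Order.chain (\<le>) C}"

definition facets :: "'a set set \<Rightarrow> 'a set set" where
  "facets K = {F \<in> K. \<forall>G \<in> K. F \<subseteq> G \<longrightarrow> F = G}"

definition maximal_chains :: "'a::order set \<Rightarrow> 'a set set" where
  "maximal_chains P = facets (poset_chains P)"

definition chain_length :: "'a set \<Rightarrow> int" where
  "chain_length C = int (card C) - 1"

definition graded_poset :: "'a::order set \<Rightarrow> bool" where
  "graded_poset P \<longleftrightarrow> (\<exists>r. \<forall>C \<in> maximal_chains P. finite C \<and> chain_length C = r)"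

text \<open>Only meaningful for graded \<open>P\<close>; the empty poset has rank \<open>-1\<close>.\<close>

definition poset_rank :: "'a::order set \<Rightarrow> int" where
  "poset_rank P = (THE r. \<forall>C \<in> maximal_chains P. chain_length C = r)"

definition principal_ideal :: "'a::order set \<Rightarrow> 'a \<Rightarrow> 'a set" where
  "principal_ideal P x = {y \<in> P. y \<le> x}"

definition element_rank :: "'a::order set \<Rightarrow> 'a \<Rightarrow> int" where
  "element_rank P x = poset_rank (principal_ideal P x)"

definition order_ideal :: "'a::order set \<Rightarrow> 'a set \<Rightarrow> bool" where
  "order_ideal P J \<longleftrightarrow> J \<subseteq> P \<and> (\<forall>x \<in> J. \<forall>y \<in> P. y \<le> x \<longrightarrow> y \<in> J)"

definition has_minimum :: "'a::order set \<Rightarrow> bool" where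
  "has_minimum P \<longleftrightarrow> (\<exists>m \<in> P. \<forall>x \<in> P. m \<le> x)"

definition has_maximum :: "'a::order set \<Rightarrow> bool" where
  "has_maximum P \<longleftrightarrow> (\<exists>m \<in> P. \<forall>x \<in> P. x \<le> m)"

definition bounded_poset :: "'a::order set \<Rightarrow> bool" where
  "bounded_poset P \<longleftrightarrow> has_minimum P \<and> has_maximum P"

definition order_complex :: "'a::order set \<Rightarrow> 'a set set" where
  "order_complex P = {C \<in> poset_chains P. finite C}"

definition generated_complex :: "'a set set \<Rightarrow> 'a set set" where
  "generated_complex S = (\<Union>F \<in> S. Pow F)"

definition maximal_proper_faces :: "'a set \<Rightarrow> 'a set set" where
  "maximal_proper_faces F = {F - {v} | v. v \<in> F}"

definition pure_complex :: "'a set set \<Rightarrow> bool" where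
  "pure_complex K \<longleftrightarrow> (\<forall>F \<in> facets K. \<forall>G \<in> facets K. card F = card G)"

definition shelling :: "'a set set \<Rightarrow> 'a set list \<Rightarrow> bool" where
  "shelling K Fs \<longleftrightarrow> distinct Fs \<and> set Fs = facets K \<and>
    (\<forall>i. 1 \<le> i \<and> i < length Fs \<longrightarrow>
      (\<exists>S. S \<noteq> {} \<and> S \<subseteq> maximal_proper_faces (Fs ! i) \<and>
        Pow (Fs ! i) \<inter> generated_complex (set (take i Fs)) = generated_complex S))"

definition shellable_complex :: "'a set set \<Rightarrow> bool" where
  "shellable_complex K \<longleftrightarrow> (\<exists>Fs. shelling K Fs)"

definition pure_shellable_poset :: "'a::order set \<Rightarrow> bool" where
  "pure_shellable_poset P \<longleftrightarrow>
    pure_complex (order_complex P) \<and> shellable_complex (order_complex P)"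

inductive strongly_constructible :: "'a::order set \<Rightarrow> bool" where
  bounded_shellable:
    "\<lbrakk>graded_poset P; has_minimum P; bounded_poset P; pure_shellable_poset P\<rbrakk>
      \<Longrightarrow> strongly_constructible P"
| ideal_union:
    "\<lbrakk>graded_poset P; has_minimum P;
      order_ideal P J1; J1 \<noteq> P; strongly_constructible J1; poset_rank J1 = poset_rank P;
      order_ideal P J2; J2 \<noteq> P; strongly_constructible J2; poset_rank J2 = poset_rank P;
      P = J1 \<union> J2;
      strongly_constructible (J1 \<inter> J2); poset_rank (J1 \<inter> J2) \<ge> poset_rank P - 1\<rbrakk>
      \<Longrightarrow> strongly_constructible P"

definition rank_preserving :: "'a::order set \<Rightarrow> 'b::order set \<Rightarrow> ('a \<Rightarrow> 'b) \<Rightarrow> bool" where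
  "rank_preserving P Q f \<longleftrightarrow> (\<forall>x \<in> P. element_rank Q (f x) = element_rank P x)"

end

theory Submission
  imports Defs
begin

text \<open>
  Induct on the strong constructibility of \<open>Q\<close>.  If \<open>Q\<close> has a maximum, then \<open>P\<close> itself is a fiber.
  If \<open>Q = J1 \<union> J2\<close>, then \<open>P\<close> is the union of the preimages of \<open>J1\<close> and \<open>J2\<close>, which meet in the
  preimage of \<open>J1 \<inter> J2\<close>; what must be checked is that these preimages are graded of the same ranks
  as the ideals.  If \<open>x\<close> is maximal in the preimage of \<open>J\<close> and \<open>q\<close> is a maximal element of \<open>J\<close>
  above \<open>f x\<close>, then the fiber over \<open>q\<close> is graded and has both \<open>x\<close> and a preimage of \<open>q\<close> among its
  maximal elements, so \<open>x\<close> and \<open>q\<close> have equal rank.  The minimum of \<open>P\<close> is that of the fiber over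
  the minimum of \<open>Q\<close>.
\<close>

lemma poset_chains_iff:
  "C \<in> poset_chains P \<longleftrightarrow> C \<subseteq> P \<and> (\<forall>x\<in>C. \<forall>y\<in>C. x \<le> y \<or> y \<le> x)"
  by (auto simp: poset_chains_def chain_def)

lemma maximal_chains_iff:
  "C \<in> maximal_chains P \<longleftrightarrow>
    C \<in> poset_chains P \<and> (\<forall>z\<in>P. (\<forall>y\<in>C. z \<le> y \<or> y \<le> z) \<longrightarrow> z \<in> C)"
  (is "_ \<longleftrightarrow> _ \<and> ?saturated")
proof
  assume C: "C \<in> maximal_chains P"
  then have chain: "C \<in> poset_chains P"
    by (simp add: maximal_chains_def facets_def)
  have "z \<in> C" if "z \<in> P" "\<forall>y\<in>C. z \<le> y \<or> y \<le> z" for z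
  proof -
    have "insert z C \<in> poset_chains P"
      using chain that by (auto simp: poset_chains_iff)
    then have "C = insert z C"
      using C unfolding maximal_chains_def facets_def by blast
    then show ?thesis by blast
  qed
  with chain show "C \<in> poset_chains P \<and> ?saturated" by blast
next
  assume C: "C \<in> poset_chains P \<and> ?saturated"
  have "G \<subseteq> C" if "G \<in> poset_chains P" "C \<subseteq> G" for G
  proof
    fix z assume "z \<in> G"
    then have "z \<in> P" "\<forall>y\<in>C. z \<le> y \<or> y \<le> z"
      using that unfolding poset_chains_iff by blast+
    then show "z \<in> C" using C by blast
  qed
  with C show "C \<in> maximal_chains P"
    unfolding maximal_chains_def facets_def by blast
qed

lemma maximal_chains_nonempty: "maximal_chains P \<noteq> {}"
proof -
  have chain: "pred_on.chain P (<) C \<longleftrightarrow> C \<in> poset_chains P" for C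
    by (auto simp: pred_on.chain_def poset_chains_iff order.order_iff_strict)
  obtain M where "pred_on.maxchain P (<) M"
    using pred_on.Hausdorff[of P "(<)"] ..
  then have "M \<in> maximal_chains P"
    by (simp add: pred_on.maxchain_def chain maximal_chains_def facets_def) (metis psubsetI)
  then show ?thesis by blast
qed

lemma maximal_chain_superset:
  assumes C: "C \<in> poset_chains P"
  obtains M where "M \<in> maximal_chains P" "C \<subseteq> M"
proof -
  define N where "N = {x \<in> P. \<forall>y\<in>C. x \<le> y \<or> y \<le> x}"
  obtain M where M: "M \<in> maximal_chains N"
    using maximal_chains_nonempty by blast
  have "C \<subseteq> M"
    using C M unfolding N_def maximal_chains_iff poset_chains_iff by blast
  moreover have "M \<in> maximal_chains P"
    using M \<open>C \<subseteq> M\<close> unfolding N_def maximal_chains_iff poset_chains_iff by blast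
  ultimately show thesis using that by blast
qed

lemma maximal_chain_through:
  assumes "x \<in> P"
  obtains M where "M \<in> maximal_chains P" "x \<in> M"
  using assms maximal_chain_superset[of "{x}" P] by (auto simp: poset_chains_iff)

lemma graded_poset_rank_iff:
  "graded_poset P \<and> poset_rank P = r \<longleftrightarrow>
    (\<forall>C\<in>maximal_chains P. finite C \<and> chain_length C = r)"
proof -
  have "poset_rank P = s" if "\<forall>C\<in>maximal_chains P. chain_length C = s" for s
    unfolding poset_rank_def
    by (rule the_equality) (use that maximal_chains_nonempty[of P] in auto)
  then show ?thesis unfolding graded_poset_def by blast
qed

lemma graded_poset_maximal_chain:
  assumes "graded_poset P" "C \<in> maximal_chains P"
  shows "finite C" "chain_length C = poset_rank P"
  using assms graded_poset_rank_iff by blast+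

lemma graded_poset_finite_chain:
  assumes "graded_poset P" "C \<in> poset_chains P"
  shows "finite C"
proof -
  obtain M where "M \<in> maximal_chains P" "C \<subseteq> M"
    using assms(2) by (rule maximal_chain_superset)
  then show ?thesis
    using graded_poset_maximal_chain(1)[OF assms(1)] finite_subset by blast
qed

definition maximal_elements :: "'a::order set \<Rightarrow> 'a set" where
  "maximal_elements P = {x \<in> P. \<forall>y\<in>P. \<not> x < y}"

lemma finite_maximal_chain_top:
  assumes C: "C \<in> maximal_chains P" "finite C" and "P \<noteq> {}"
  obtains x where "x \<in> maximal_elements P" "C \<in> maximal_chains (principal_ideal P x)"
proof -
  have "C \<noteq> {}" using C(1) \<open>P \<noteq> {}\<close> by (auto simp: maximal_chains_iff)
  then obtain x where "x \<in> C" "\<And>y. y \<in> C \<Longrightarrow> x \<le> y \<Longrightarrow> x = y"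
    using finite_has_maximal[OF C(2)] by metis
  then have top: "y \<le> x" if "y \<in> C" for y
    using C(1) that by (fastforce simp: maximal_chains_iff poset_chains_iff)
  show thesis
  proof
    have "y \<in> C" if "y \<in> P" "x < y" for y
      using C(1) that top by (force simp: maximal_chains_iff)
    then show "x \<in> maximal_elements P"
      using C(1) \<open>x \<in> C\<close> top
      by (force simp: maximal_elements_def maximal_chains_iff poset_chains_iff)
    show "C \<in> maximal_chains (principal_ideal P x)"
      using C(1) top by (auto simp: maximal_chains_iff poset_chains_iff principal_ideal_def)
  qed
qed

lemma graded_poset_maximal_element_above:
  assumes P: "graded_poset P" and x: "x \<in> P"
  obtains m where "m \<in> maximal_elements P" "x \<le> m"
proof -
  obtain C where C: "C \<in> maximal_chains P" "x \<in> C"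
    using x by (rule maximal_chain_through)
  moreover have "finite C" "P \<noteq> {}"
    using graded_poset_maximal_chain(1)[OF P C(1)] x by auto
  ultimately obtain m where m: "m \<in> maximal_elements P" "C \<in> maximal_chains (principal_ideal P m)"
    using finite_maximal_chain_top by blast
  with C(2) have "x \<le> m"
    by (auto simp: maximal_chains_iff poset_chains_iff principal_ideal_def)
  with m(1) show thesis by (rule that)
qed

lemma maximal_chain_splice:
  assumes D: "D \<in> maximal_chains (principal_ideal P x)"
    and M: "M \<in> maximal_chains P" "x \<in> M"
  shows "D \<union> {y \<in> M. x < y} \<in> maximal_chains P"
proof -
  have "x \<in> P" using M by (auto simp: maximal_chains_iff poset_chains_iff)
  then have "x \<in> D" using D by (auto simp: maximal_chains_iff poset_chains_iff principal_ideal_def)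
  have below: "y \<le> x" if "y \<in> D" for y
    using D that by (auto simp: maximal_chains_iff poset_chains_iff principal_ideal_def)
  have "a \<le> b" if "a \<in> D" "b \<in> {y \<in> M. x < y}" for a b
    using below[OF that(1)] that(2) by auto
  then have "D \<union> {y \<in> M. x < y} \<in> poset_chains P"
    using D M(1) unfolding maximal_chains_iff poset_chains_iff principal_ideal_def by blast
  moreover have "z \<in> D \<union> {y \<in> M. x < y}"
    if z: "z \<in> P" "\<forall>y \<in> D \<union> {y \<in> M. x < y}. z \<le> y \<or> y \<le> z" for z
  proof (cases "z \<le> x")
    case True
    then show ?thesis
      using D z by (auto simp: maximal_chains_iff principal_ideal_def)
  next
    case False
    then have "x < z" using z \<open>x \<in> D\<close> by auto
    moreover have "y \<le> x \<or> x < y" if "y \<in> M" for y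
      using M that by (auto simp: maximal_chains_iff poset_chains_iff less_le)
    ultimately have "z \<le> y \<or> y \<le> z" if "y \<in> M" for y
      using z(2) that by force
    then have "z \<in> M" using M(1) z(1) by (auto simp: maximal_chains_iff)
    with \<open>x < z\<close> show ?thesis by blast
  qed
  ultimately show ?thesis by (auto simp: maximal_chains_iff)
qed

lemma principal_ideal_graded_rank:
  assumes P: "graded_poset P" and M: "M \<in> maximal_chains P" "x \<in> M"
  shows "graded_poset (principal_ideal P x) \<and>
    element_rank P x = poset_rank P - int (card {y \<in> M. x < y})"
  unfolding element_rank_def graded_poset_rank_iff
proof
  fix D assume D: "D \<in> maximal_chains (principal_ideal P x)"
  let ?U = "{y \<in> M. x < y}"
  have splice: "finite (D \<union> ?U)" "chain_length (D \<union> ?U) = poset_rank P"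
    using graded_poset_maximal_chain[OF P maximal_chain_splice[OF D M]] by blast+
  have "D \<inter> ?U = {}"
    using D by (force simp: maximal_chains_iff poset_chains_iff principal_ideal_def)
  then have "card (D \<union> ?U) = card D + card ?U"
    using splice(1) by (intro card_Un_disjoint) auto
  then show "finite D \<and> chain_length D = poset_rank P - int (card ?U)"
    using splice by (simp add: chain_length_def)
qed

lemma graded_principal_ideal:
  assumes "graded_poset P" "x \<in> P"
  shows "graded_poset (principal_ideal P x)"
proof -
  obtain M where "M \<in> maximal_chains P" "x \<in> M"
    using assms(2) by (rule maximal_chain_through)
  then show ?thesis
    using principal_ideal_graded_rank[OF assms(1)] by blast
qed

lemma element_rank_maximal:
  assumes P: "graded_poset P" and x: "x \<in> maximal_elements P"
  shows "element_rank P x = poset_rank P"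
proof -
  obtain M where M: "M \<in> maximal_chains P" "x \<in> M"
    using x maximal_chain_through unfolding maximal_elements_def by blast
  have "{y \<in> M. x < y} = {}"
    using x M(1) by (auto simp: maximal_elements_def maximal_chains_iff poset_chains_iff)
  then show ?thesis
    using principal_ideal_graded_rank[OF P M] by (metis card.empty diff_0_right of_nat_0)
qed

lemma order_ideal_refl: "order_ideal P P"
  by (simp add: order_ideal_def)

lemma order_ideal_Int: "order_ideal P I \<Longrightarrow> order_ideal P J \<Longrightarrow> order_ideal P (I \<inter> J)"
  by (auto simp: order_ideal_def)

lemma order_ideal_principal_ideal: "order_ideal P (principal_ideal P x)"
  by (auto simp: order_ideal_def principal_ideal_def)

lemma principal_ideal_subset: "order_ideal P J \<Longrightarrow> x \<in> J \<Longrightarrow> principal_ideal P x \<subseteq> J"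
  by (auto simp: order_ideal_def principal_ideal_def)

lemma principal_ideal_order_ideal:
  "order_ideal P J \<Longrightarrow> x \<in> J \<Longrightarrow> principal_ideal J x = principal_ideal P x"
  by (auto simp: order_ideal_def principal_ideal_def)

lemma element_rank_order_ideal:
  "order_ideal P J \<Longrightarrow> x \<in> J \<Longrightarrow> element_rank J x = element_rank P x"
  by (simp add: element_rank_def principal_ideal_order_ideal)

lemma order_ideal_vimage:
  assumes "mono_on P f" "f ` P \<subseteq> Q" "order_ideal Q J"
  shows "order_ideal P (P \<inter> f -` J)"
  using assms unfolding order_ideal_def mono_on_def by blast

lemma graded_order_ideal_rank:
  assumes P: "graded_poset P" and J: "order_ideal P J" "J \<noteq> {}"
    and rank: "\<And>x. x \<in> maximal_elements J \<Longrightarrow> element_rank P x = r"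
  shows "graded_poset J \<and> poset_rank J = r"
  unfolding graded_poset_rank_iff
proof
  fix C assume C: "C \<in> maximal_chains J"
  have "J \<subseteq> P" using J(1) by (simp add: order_ideal_def)
  then have "C \<in> poset_chains P" using C by (auto simp: maximal_chains_iff poset_chains_iff)
  with P have "finite C" by (rule graded_poset_finite_chain)
  with C obtain x where x: "x \<in> maximal_elements J" "C \<in> maximal_chains (principal_ideal J x)"
    using finite_maximal_chain_top J(2) by blast
  then have "x \<in> J" by (simp add: maximal_elements_def)
  then have "C \<in> maximal_chains (principal_ideal P x)"
    using x(2) principal_ideal_order_ideal[OF J(1)] by simp
  then have "chain_length C = element_rank P x"
    unfolding element_rank_def using P \<open>x \<in> J\<close> \<open>J \<subseteq> P\<close>
    by (intro graded_poset_maximal_chain(2) graded_principal_ideal) auto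
  with \<open>finite C\<close> rank[OF x(1)] show "finite C \<and> chain_length C = r" by simp
qed

lemma has_minimum_if_fibers_have_minimum:
  assumes f: "mono_on P f" "f ` P \<subseteq> Q" and Q: "has_minimum Q"
    and fibers: "\<And>q. q \<in> Q \<Longrightarrow> has_minimum (P \<inter> f -` principal_ideal Q q)"
  shows "has_minimum P"
proof -
  obtain m where m: "m \<in> Q" "\<And>q. q \<in> Q \<Longrightarrow> m \<le> q"
    using Q unfolding has_minimum_def by blast
  obtain b where b: "b \<in> P" "f b \<le> m" "\<And>y. y \<in> P \<Longrightarrow> f y \<le> m \<Longrightarrow> b \<le> y"
    using fibers[OF m(1)] f(2) unfolding has_minimum_def principal_ideal_def by auto
  have "b \<le> x" if "x \<in> P" for x
  proof -
    have "f x \<in> Q" using f(2) that by blast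
    then obtain y where y: "y \<in> P" "\<And>z. z \<in> P \<Longrightarrow> f z \<le> f x \<Longrightarrow> y \<le> z"
      using fibers[OF \<open>f x \<in> Q\<close>] f(2) unfolding has_minimum_def principal_ideal_def by auto
    have "y \<le> b" using b(1,2) m(2)[OF \<open>f x \<in> Q\<close>] by (intro y(2)) auto
    then have "f y \<le> m" using mono_onD[OF f(1) y(1) b(1)] b(2) by auto
    then have "b \<le> y" using b(3) y(1) by blast
    also have "y \<le> x" using y(2) that by blast
    finally show ?thesis .
  qed
  with b(1) show ?thesis unfolding has_minimum_def by blast
qed

locale rank_preserving_surjection =
  fixes P :: "'a::order set" and Q :: "'b::order set" and f :: "'a \<Rightarrow> 'b"
  assumes graded_domain: "graded_poset P"
    and mono: "mono_on P f"
    and surjective: "f ` P = Q"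
    and rank_preserving: "rank_preserving P Q f"
begin

abbreviation preimage :: "'b set \<Rightarrow> 'a set" where
  "preimage J \<equiv> P \<inter> f -` J"

abbreviation fiber :: "'b \<Rightarrow> 'a set" where
  "fiber q \<equiv> preimage (principal_ideal Q q)"

lemma order_ideal_preimage: "order_ideal Q J \<Longrightarrow> order_ideal P (preimage J)"
  using order_ideal_vimage[OF mono] surjective by blast

lemma order_ideal_fiber: "order_ideal P (fiber q)"
  by (intro order_ideal_preimage order_ideal_principal_ideal)

lemma preimage_nonempty: "order_ideal Q J \<Longrightarrow> J \<noteq> {} \<Longrightarrow> preimage J \<noteq> {}"
  using surjective unfolding order_ideal_def by blast

lemma preimage_codomain: "preimage Q = P"
  using surjective by blast

lemma preimage_proper: "order_ideal Q J \<Longrightarrow> J \<noteq> Q \<Longrightarrow> preimage J \<noteq> P"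
  using surjective unfolding order_ideal_def by blast

lemma element_rank_image: "x \<in> P \<Longrightarrow> element_rank Q (f x) = element_rank P x"
  using rank_preserving unfolding rank_preserving_def by blast

lemma poset_rank_fiber:
  assumes q: "q \<in> Q" and graded: "graded_poset (fiber q)"
  shows "poset_rank (fiber q) = element_rank Q q"
proof -
  obtain w where w: "w \<in> P" "f w = q"
    using q surjective by blast
  then have "w \<in> fiber q" using q by (simp add: principal_ideal_def)
  with graded obtain y where y: "y \<in> maximal_elements (fiber q)" "w \<le> y"
    by (rule graded_poset_maximal_element_above)
  then have yF: "y \<in> fiber q" by (simp add: maximal_elements_def)
  have "q \<le> f y" using mono_onD[OF mono w(1) _ y(2)] yF w(2) by blast
  then have "f y = q" using yF by (auto simp: principal_ideal_def)
  have "poset_rank (fiber q) = element_rank (fiber q) y"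
    using element_rank_maximal[OF graded y(1)] by simp
  also have "\<dots> = element_rank P y"
    by (rule element_rank_order_ideal[OF order_ideal_fiber yF])
  also have "\<dots> = element_rank Q q"
    using element_rank_image yF \<open>f y = q\<close> by force
  finally show ?thesis .
qed

lemma element_rank_maximal_preimage:
  assumes J: "order_ideal Q J" "graded_poset J"
    and fibers: "\<And>q. q \<in> J \<Longrightarrow> graded_poset (fiber q)"
    and x: "x \<in> maximal_elements (preimage J)"
  shows "element_rank P x = poset_rank J"
proof -
  have "x \<in> P" "f x \<in> J" using x by (auto simp: maximal_elements_def)
  with J(2) obtain q where q: "q \<in> maximal_elements J" "f x \<le> q"
    using graded_poset_maximal_element_above by blast
  then have "q \<in> J" by (simp add: maximal_elements_def)
  then have "q \<in> Q" using J(1) by (auto simp: order_ideal_def)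
  have xF: "x \<in> fiber q"
    using \<open>x \<in> P\<close> q(2) surjective by (auto simp: principal_ideal_def)
  have "fiber q \<subseteq> preimage J"
    using principal_ideal_subset[OF J(1) \<open>q \<in> J\<close>] by blast
  then have "x \<in> maximal_elements (fiber q)"
    using x xF by (auto simp: maximal_elements_def)
  then have "element_rank (fiber q) x = poset_rank (fiber q)"
    by (rule element_rank_maximal[OF fibers[OF \<open>q \<in> J\<close>]])
  then have "element_rank P x = poset_rank (fiber q)"
    by (simp only: element_rank_order_ideal[OF order_ideal_fiber xF])
  also have "\<dots> = element_rank Q q"
    by (rule poset_rank_fiber[OF \<open>q \<in> Q\<close> fibers[OF \<open>q \<in> J\<close>]])
  also have "\<dots> = element_rank J q"
    by (rule element_rank_order_ideal[OF J(1) \<open>q \<in> J\<close>, symmetric])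
  also have "\<dots> = poset_rank J"
    by (rule element_rank_maximal[OF J(2) q(1)])
  finally show ?thesis .
qed

lemma preimage_graded_rank:
  assumes "order_ideal Q J" "graded_poset J" "J \<noteq> {}"
    and "\<And>q. q \<in> J \<Longrightarrow> graded_poset (fiber q)"
  shows "graded_poset (preimage J)" "poset_rank (preimage J) = poset_rank J"
  using graded_order_ideal_rank[OF graded_domain order_ideal_preimage preimage_nonempty]
    element_rank_maximal_preimage assms by blast+

lemma rank_preserving_surjection_preimage:
  assumes J: "order_ideal Q J" and graded: "graded_poset (preimage J)"
  shows "rank_preserving_surjection (preimage J) J f"
proof
  show "mono_on (preimage J) f" using mono mono_on_subset by blast
  show "f ` preimage J = J" using surjective J by (auto simp: order_ideal_def)
  show "rank_preserving (preimage J) J f"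
    unfolding rank_preserving_def
    using element_rank_image element_rank_order_ideal[OF J]
      element_rank_order_ideal[OF order_ideal_preimage[OF J]] by simp
qed (fact graded)

end

lemma strongly_constructible_graded: "strongly_constructible P \<Longrightarrow> graded_poset P"
  by (auto elim: strongly_constructible.cases)

lemma strongly_constructible_has_minimum: "strongly_constructible P \<Longrightarrow> has_minimum P"
  by (auto elim: strongly_constructible.cases)

lemma strongly_constructible_nonempty: "strongly_constructible P \<Longrightarrow> P \<noteq> {}"
  using strongly_constructible_has_minimum unfolding has_minimum_def by blast

locale strongly_constructible_fibration = rank_preserving_surjection +
  assumes strongly_constructible_fiber: "q \<in> Q \<Longrightarrow> strongly_constructible (fiber q)"
begin

lemma strongly_constructible_preimage_graded_rank:
  assumes J: "order_ideal Q J" "strongly_constructible J"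
  shows "graded_poset (preimage J)" "poset_rank (preimage J) = poset_rank J"
proof -
  have "graded_poset (fiber q)" if "q \<in> J" for q
    using that J(1) strongly_constructible_fiber strongly_constructible_graded
    by (auto simp: order_ideal_def)
  then show "graded_poset (preimage J)" "poset_rank (preimage J) = poset_rank J"
    using preimage_graded_rank[OF J(1)] J(2) strongly_constructible_graded
      strongly_constructible_nonempty by blast+
qed

lemma strongly_constructible_fibration_preimage:
  assumes J: "order_ideal Q J" "strongly_constructible J"
  shows "strongly_constructible_fibration (preimage J) J f"
proof (intro strongly_constructible_fibration.intro strongly_constructible_fibration_axioms.intro)
  show "rank_preserving_surjection (preimage J) J f"
    by (intro rank_preserving_surjection_preimage strongly_constructible_preimage_graded_rank J)
  fix q assume "q \<in> J"
  then have "preimage J \<inter> f -` principal_ideal J q = fiber q" "q \<in> Q"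
    using J(1) by (auto simp: order_ideal_def principal_ideal_def)
  then show "strongly_constructible (preimage J \<inter> f -` principal_ideal J q)"
    using strongly_constructible_fiber by simp
qed

lemma poset_rank_domain:
  assumes "strongly_constructible Q"
  shows "poset_rank P = poset_rank Q"
  using strongly_constructible_preimage_graded_rank(2)[OF order_ideal_refl assms] preimage_codomain
  by simp

lemma has_minimum_domain: "has_minimum Q \<Longrightarrow> has_minimum P"
  using has_minimum_if_fibers_have_minimum[OF mono] surjective
    strongly_constructible_has_minimum strongly_constructible_fiber by blast

lemma strongly_constructible_if_has_maximum:
  assumes "has_maximum Q"
  shows "strongly_constructible P"
proof -
  obtain q where "q \<in> Q" "\<And>x. x \<in> Q \<Longrightarrow> x \<le> q"
    using assms unfolding has_maximum_def by blast
  moreover from this have "fiber q = P"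
    using surjective by (auto simp: principal_ideal_def)
  ultimately show ?thesis using strongly_constructible_fiber by metis
qed

end

lemma strongly_constructible_fibration_domain:
  assumes "strongly_constructible Q" "strongly_constructible_fibration P Q f"
  shows "strongly_constructible P"
  using assms
proof (induction arbitrary: P rule: strongly_constructible.induct)
  case (bounded_shellable Q)
  then show ?case
    using strongly_constructible_fibration.strongly_constructible_if_has_maximum
    unfolding bounded_poset_def by blast
next
  case (ideal_union Q J1 J2)
  interpret strongly_constructible_fibration P Q f by (rule ideal_union.prems)
  note J1 = \<open>order_ideal Q J1\<close> \<open>strongly_constructible J1\<close>
  note J2 = \<open>order_ideal Q J2\<close> \<open>strongly_constructible J2\<close>
  note Int = order_ideal_Int[OF J1(1) J2(1)] \<open>strongly_constructible (J1 \<inter> J2)\<close>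
  have preimage_Int: "preimage J1 \<inter> preimage J2 = preimage (J1 \<inter> J2)" by blast
  note rank = strongly_constructible_preimage_graded_rank(2)
  have rank_P: "poset_rank P = poset_rank Q"
    by (intro poset_rank_domain strongly_constructible.ideal_union[OF ideal_union.hyps])
  show ?case
  proof (rule strongly_constructible.ideal_union[of P "preimage J1" "preimage J2",
        unfolded preimage_Int])
    show "graded_poset P" "has_minimum P"
      using graded_domain has_minimum_domain \<open>has_minimum Q\<close> by blast+
    show "P = preimage J1 \<union> preimage J2"
      using preimage_codomain \<open>Q = J1 \<union> J2\<close> by blast
    show "order_ideal P (preimage J1)" "order_ideal P (preimage J2)"
      using order_ideal_preimage J1(1) J2(1) by blast+
    show "preimage J1 \<noteq> P" "preimage J2 \<noteq> P"
      using preimage_proper J1(1) J2(1) \<open>J1 \<noteq> Q\<close> \<open>J2 \<noteq> Q\<close> by blast+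
    show "strongly_constructible (preimage J1)" "strongly_constructible (preimage J2)"
      "strongly_constructible (preimage (J1 \<inter> J2))"
      using ideal_union.IH strongly_constructible_fibration_preimage J1 J2 Int by blast+
    show "poset_rank (preimage J1) = poset_rank P" "poset_rank (preimage J2) = poset_rank P"
      "poset_rank P - 1 \<le> poset_rank (preimage (J1 \<inter> J2))"
      using rank[OF J1] rank[OF J2] rank[OF Int] rank_P ideal_union.hyps by simp_all
  qed
qed

theorem theorem3p7:
  fixes P :: "'a::order set" and Q :: "'b::order set" and f :: "'a \<Rightarrow> 'b"
  assumes "finite P" and "graded_poset P"
    and "finite Q" and "graded_poset Q"
    and "mono_on P f" and "f ` P = Q" and "rank_preserving P Q f"
    and "\<And>q. q \<in> Q \<Longrightarrow> strongly_constructible (P \<inter> f -` principal_ideal Q q)"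
    and "strongly_constructible Q"
  shows "strongly_constructible P"
proof -
  have "strongly_constructible_fibration P Q f"
    by unfold_locales (use assms in blast)+
  with \<open>strongly_constructible Q\<close> show ?thesis
    by (rule strongly_constructible_fibration_domain)
qed

end
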